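(* There exist universal constants $C_1, C_2 > 0$ such that the following holds. Let $x_1,\dots,x_n \in \mathbb{R}^2$ satisfy the standing assumptions below, let $\gamma$ be their maximum margin, and suppose the step size satisfies $\eta \geq \eta_0 := \max\left(n, \frac{32}{\gamma^2}\log\frac{256}{\gamma^2}\right)$. Then the transition time $\tau := \min\{t \geq 0 : F(w_t) \leq 1/(8\eta)\}$ of gradient descent satisfies $$\tau \leq C_1\left(\frac{n}{\gamma} + \frac{\log(1/\gamma)}{\gamma^2}\right),$$ and moreover $F(w_t) \leq \frac{C_2}{\eta \gamma^2 (t-\tau)}$ for all integers $t > \tau$.
   Context: Dimension $d=2$. Data: $x_1,\dots,x_n \in \mathbb{R}^2$ (all labels equal to $+1$) with $\|x_i\| \leq 1$ for all $i$, linearly separable: there exists $w$ with $\langle w, x_i\rangle > 0$ for all $i \in [n]$. Let $\ell(z) = \log(1+e^{-z})$ and $F(w) = \frac{1}{n}\sum_{i=1}^n \ell(\langle w, x_i\rangle)$. The maximum margin is $\gamma = \max_{\|w\|=1}\min_{i\in[n]} \langle w, x_i\rangle$ (so $0<\gamma\le 1$). Gradient descent with constant step size $\eta>0$: $w_0 = 0$, $w_{t+1} = w_t - \eta \nabla F(w_t)$. *)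

theory Defs
  imports "HOL-Analysis.Analysis"
begin

definition logloss :: "real \<Rightarrow> real" where
  "logloss z = ln (1 + exp (- z))"

definition logloss' :: "real \<Rightarrow> real" where
  "logloss' z = - 1 / (1 + exp z)"

definition risk :: "nat \<Rightarrow> (nat \<Rightarrow> real^2) \<Rightarrow> real^2 \<Rightarrow> real" where
  "risk n x w = (1 / real n) * (\<Sum>i<n. logloss (w \<bullet> x i))"

definition risk_grad :: "nat \<Rightarrow> (nat \<Rightarrow> real^2) \<Rightarrow> real^2 \<Rightarrow> real^2" where
  "risk_grad n x w = (1 / real n) *\<^sub>R (\<Sum>i<n. logloss' (w \<bullet> x i) *\<^sub>R x i)"

fun gd :: "nat \<Rightarrow> (nat \<Rightarrow> real^2) \<Rightarrow> real \<Rightarrow> nat \<Rightarrow> real^2" where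
  "gd n x eta 0 = 0"
| "gd n x eta (Suc t) = gd n x eta t - eta *\<^sub>R risk_grad n x (gd n x eta t)"

definition max_margin :: "nat \<Rightarrow> (nat \<Rightarrow> real^2) \<Rightarrow> real" where
  "max_margin n x = (SUP w\<in>{w::real^2. norm w = 1}. Min ((\<lambda>i. w \<bullet> x i) ` {..<n}))"

end

theory Submission
  imports Defs
begin

text \<open>Let \<open>p\<close> be a maximum margin direction, \<open>c\<close> the margin and \<open>q \<bottom> p\<close>, and follow the coordinates
  \<open>P = \<langle>w, p\<rangle>\<close>, \<open>Q = \<langle>w, q\<rangle>\<close>. From the first step on \<open>P \<ge> \<eta> c / 2\<close>, and \<open>P\<close> never decreases. Points on
  the same side as \<open>Q\<close> have margin at least \<open>\<eta> c\<^sup>2 / 2\<close>, so they contribute a gradient negligible even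
  against \<open>1 / \<eta>\<^sup>2\<close>: only the opposite (active) points matter, and they pull \<open>Q\<close> towards \<open>0\<close>. As long
  as \<open>Q\<close> keeps its sign, the active margins grow, so the mean active gradient weight \<open>h\<close> decreases.
  While the risk exceeds \<open>1 / (8 \<eta>)\<close> we have \<open>c P / 2 \<le> \<bar>Q\<bar> \<le> \<eta>\<close>; hence a sign change of \<open>Q\<close> needs
  \<open>\<eta> h \<ge> c P / 4\<close>, and by monotonicity so does every step preceding a sign change. All these steps
  multiply \<open>P\<close> by \<open>1 + c\<^sup>2 / 4\<close>, and \<open>P\<close> lives in \<open>[\<eta> c / 2, 2 \<eta> / c]\<close>, so there are
  \<open>O(log (1 / c) / c\<^sup>2)\<close> of them. After the last sign change each misclassified point is corrected
  within \<open>2 n / c\<close> steps, and then \<open>1 / h\<close> grows by \<open>\<eta> c\<^sup>2 / 4\<close> per step up to \<open>O(\<eta>)\<close>. Once the risk is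
  below \<open>1 / (8 \<eta>)\<close>, a self-bounding descent estimate gives \<open>F' \<le> F - \<eta> c\<^sup>2 F\<^sup>2 / 8\<close>.\<close>

subsection \<open>Logistic loss\<close>

text \<open>The negated derivative of \<open>logloss\<close>: a positive decreasing weight, so that
  signs need not be tracked through \<open>logloss'\<close>.\<close>

definition sigm :: "real \<Rightarrow> real" where
  "sigm z = 1 / (1 + exp z)"

lemma one_plus_exp_pos [simp]: "0 < 1 + exp (z::real)" "1 + exp (z::real) \<noteq> 0"
  by (smt (verit) exp_gt_zero)+

lemma sigm_pos: "0 < sigm z"
  by (simp add: sigm_def)

lemma sigm_le_1: "sigm z \<le> 1"
  by (simp add: sigm_def)

lemma sigm_le_exp: "sigm z \<le> exp (- z)"
  by (simp add: sigm_def exp_minus field_simps)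

lemma sigm_antimono: "y \<le> z \<Longrightarrow> sigm z \<le> sigm y"
  by (simp add: sigm_def frac_le)

lemma sigm_ge_half: "z \<le> 0 \<Longrightarrow> 1/2 \<le> sigm z"
  using sigm_antimono[of z 0] by (simp add: sigm_def)

lemma exp_le_2_sigm: "0 \<le> z \<Longrightarrow> exp (- z) \<le> 2 * sigm z"
  by (simp add: sigm_def exp_minus field_simps)

text \<open>For \<open>z >= 0\<close> the constant 1 in \<open>1 + exp z\<close> is at most
  \<open>exp z\<close>, so it costs at most half of the relative growth \<open>d\<close>. This later
  turns growth of a margin into linear growth of an inverse weight.\<close>

lemma sigm_add_le:
  assumes "0 \<le> z" "0 \<le> d"
  shows "sigm (z + d) * (1 + d / 2) \<le> sigm z"
proof -
  have "(1 + exp z) * (1 + d / 2) \<le> 1 + exp z * (1 + d)"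
  proof -
    have "d / 2 \<le> exp z * (d / 2)" using assms by (simp add: mult_le_cancel_right1)
    then show ?thesis by (simp add: algebra_simps)
  qed
  also have "\<dots> \<le> 1 + exp (z + d)"
    using exp_ge_add_one_self[of d] by (simp add: exp_add)
  finally show ?thesis
    by (simp add: sigm_def pos_le_divide_eq pos_divide_le_eq mult.commute)
qed

lemma logloss_pos: "0 < logloss z"
  by (simp add: logloss_def)

lemma logloss_le_exp: "logloss z \<le> exp (- z)"
  unfolding logloss_def by (rule ln_add_one_self_le_self) simp

text \<open>This is \<open>ln y <= y - 1\<close> at \<open>y = 1 / (1 + exp (- z))\<close>, because
  \<open>1 - y = sigm z\<close>.\<close>

lemma sigm_le_logloss: "sigm z \<le> logloss z"
proof -
  have "- ln (1 + exp (- z)) \<le> inverse (1 + exp (- z)) - 1"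
    using ln_le_minus_one[of "inverse (1 + exp (- z))"] by (simp add: ln_inverse)
  also have "\<dots> = - sigm z"
    by (simp add: sigm_def exp_minus field_simps)
  finally show ?thesis by (simp add: logloss_def)
qed

lemma logloss_le_2_sigm: "0 \<le> z \<Longrightarrow> logloss z \<le> 2 * sigm z"
  using logloss_le_exp exp_le_2_sigm order_trans by blast

lemma logloss'_sigm: "logloss' z = - sigm z"
  by (simp add: logloss'_def sigm_def)

text \<open>Multiply by \<open>1 - x > 0\<close>: the left side becomes at most
  \<open>exp x * exp (- x) = 1\<close>, the right side \<open>1 + x^2 * (1 - 2 * x)\<close>.\<close>

lemma exp_le_quadratic:
  fixes x :: real
  assumes "\<bar>x\<bar> \<le> 1/2"
  shows "exp x \<le> 1 + x + 2 * x\<^sup>2"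
proof -
  have "exp x * (1 - x) \<le> exp x * exp (- x)"
    using exp_ge_add_one_self[of "- x"] by (intro mult_left_mono) auto
  then have 1: "exp x * (1 - x) \<le> 1" by (simp flip: exp_add)
  have "0 \<le> x\<^sup>2 * (1 - 2 * x)" using assms by (intro mult_nonneg_nonneg) auto
  then have "1 \<le> (1 + x + 2 * x\<^sup>2) * (1 - x)"
    by (simp add: algebra_simps power2_eq_square)
  with 1 have "exp x * (1 - x) \<le> (1 + x + 2 * x\<^sup>2) * (1 - x)" by linarith
  then show ?thesis using assms by (simp add: mult_le_cancel_right)
qed

text \<open>A self-bounding Taylor estimate: the quadratic term carries the factor
  \<open>sigm z\<close> instead of a fixed smoothness constant, so long steps remain controlled
  where the loss is small.\<close>

lemma logloss_add_le:
  assumes "\<bar>d\<bar> \<le> 1/2"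
  shows "logloss (z + d) \<le> logloss z - sigm z * d + 2 * sigm z * d\<^sup>2"
proof -
  have eq: "1 + exp (- (z + d)) = (1 + exp (- z)) * (1 + sigm z * (exp (- d) - 1))"
  proof -
    have "exp (- z) = sigm z * (1 + exp (- z))"
      by (simp add: sigm_def exp_minus field_simps)
    moreover have "exp (- (z + d)) = exp (- z) * exp (- d)" by (simp flip: exp_add)
    ultimately show ?thesis by algebra
  qed
  have pos: "0 < 1 + sigm z * (exp (- d) - 1)"
    using eq by (metis one_plus_exp_pos(1) zero_less_mult_pos)
  have "logloss (z + d) = logloss z + ln (1 + sigm z * (exp (- d) - 1))"
    unfolding logloss_def eq by (rule ln_mult_pos) (use pos in auto)
  also have "\<dots> \<le> logloss z + sigm z * (exp (- d) - 1)"
    using ln_le_minus_one[OF pos] by simp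
  also have "\<dots> \<le> logloss z + sigm z * (- d + 2 * d\<^sup>2)"
    using exp_le_quadratic[of "- d"] assms sigm_pos[of z]
    by (intro add_left_mono mult_left_mono) auto
  finally show ?thesis by (simp add: algebra_simps)
qed

subsection \<open>Stable phase\<close>

text \<open>The mean gradient weight. It bounds the norm of the gradient from above and, multiplied
  by the margin, from below.\<close>

definition mean_sigm :: "nat \<Rightarrow> (nat \<Rightarrow> real^2) \<Rightarrow> real^2 \<Rightarrow> real" where
  "mean_sigm n x w = (1 / real n) * (\<Sum>i<n. sigm (w \<bullet> x i))"

lemma mean_sigm_le_risk: "mean_sigm n x w \<le> risk n x w"
  unfolding mean_sigm_def risk_def
  by (intro mult_left_mono sum_mono sigm_le_logloss) auto

lemma risk_pos: "n \<ge> 1 \<Longrightarrow> 0 < risk n x w"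
  unfolding risk_def by (intro mult_pos_pos sum_pos logloss_pos) (auto simp: lessThan_empty_iff)

lemma inner_risk_grad: "risk_grad n x w \<bullet> v = - (1 / real n) * (\<Sum>i<n. sigm (w \<bullet> x i) * (x i \<bullet> v))"
  by (simp add: risk_grad_def logloss'_sigm inner_sum_left sum_negf)

lemma norm_risk_grad_le:
  assumes "\<And>i. i < n \<Longrightarrow> norm (x i) \<le> 1"
  shows "norm (risk_grad n x w) \<le> mean_sigm n x w"
proof -
  have "norm (\<Sum>i<n. logloss' (w \<bullet> x i) *\<^sub>R x i) \<le> (\<Sum>i<n. sigm (w \<bullet> x i))"
    using assms sigm_pos
    by (intro sum_norm_le) (auto simp: logloss'_sigm abs_of_pos mult_le_cancel_left1 not_less)
  then show ?thesis
    by (simp add: risk_grad_def mean_sigm_def divide_right_mono)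
qed

text \<open>A risk of at most \<open>1 / (8 * eta)\<close> forces \<open>eta * G <= 1/8\<close>, so
  no margin moves by more than 1/8 and \<open>logloss_add_le\<close> applies to every point. Its
  quadratic terms then consume at most a quarter of the first-order gain
  \<open>eta * (norm g)^2\<close>.\<close>

lemma risk_descent:
  assumes n: "n \<ge> 1" and x: "\<And>i. i < n \<Longrightarrow> norm (x i) \<le> 1" and eta: "0 < eta"
    and small: "risk n x w \<le> 1 / (8 * eta)"
  shows "risk n x (w - eta *\<^sub>R risk_grad n x w)
    \<le> risk n x w - 3/4 * eta * (norm (risk_grad n x w))\<^sup>2"
proof -
  define g where "g = risk_grad n x w"
  define G where "G = mean_sigm n x w"
  define v where "v = - (eta *\<^sub>R g)"
  have G: "eta * G \<le> 1/8"
    using mult_left_mono[OF order_trans[OF mean_sigm_le_risk small], of eta] eta by (simp add: G_def)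
  have nv: "norm v = eta * norm g" using eta by (simp add: v_def)
  have "norm v \<le> eta * G"
    unfolding nv using norm_risk_grad_le[OF x, where w = w] eta by (simp add: g_def G_def)
  then have v8: "norm v \<le> 1/8" using G by linarith
  have d: "\<bar>v \<bullet> x i\<bar> \<le> norm v" if "i < n" for i
    using Cauchy_Schwarz_ineq2[of v "x i"] mult_left_mono[OF x[OF that], of "norm v"] by simp
  have "(\<Sum>i<n. logloss (w \<bullet> x i + v \<bullet> x i))
    \<le> (\<Sum>i<n. logloss (w \<bullet> x i) - sigm (w \<bullet> x i) * (x i \<bullet> v) + 2 * (norm v)\<^sup>2 * sigm (w \<bullet> x i))"
  proof (rule sum_mono)
    fix i assume "i \<in> {..<n}"
    then have di: "\<bar>v \<bullet> x i\<bar> \<le> norm v" using d by simp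
    have "logloss (w \<bullet> x i + v \<bullet> x i) \<le> logloss (w \<bullet> x i) - sigm (w \<bullet> x i) * (v \<bullet> x i)
        + 2 * sigm (w \<bullet> x i) * (v \<bullet> x i)\<^sup>2"
      using di v8 by (intro logloss_add_le) linarith
    also have "(v \<bullet> x i)\<^sup>2 \<le> (norm v)\<^sup>2"
      using di by (simp flip: abs_le_square_iff)
    finally show "logloss (w \<bullet> x i + v \<bullet> x i) \<le> logloss (w \<bullet> x i)
        - sigm (w \<bullet> x i) * (x i \<bullet> v) + 2 * (norm v)\<^sup>2 * sigm (w \<bullet> x i)"
      using sigm_pos[of "w \<bullet> x i"] by (simp add: inner_commute mult_ac)
  qed
  also have "\<dots> = (\<Sum>i<n. logloss (w \<bullet> x i)) - (\<Sum>i<n. sigm (w \<bullet> x i) * (x i \<bullet> v))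
      + 2 * (norm v)\<^sup>2 * (\<Sum>i<n. sigm (w \<bullet> x i))"
    by (simp add: sum.distrib sum_subtractf sum_distrib_left)
  finally have "risk n x (w + v) \<le> (1 / real n) * \<dots>"
    unfolding risk_def by (intro mult_left_mono) (auto simp: inner_add_left)
  also have "\<dots> = risk n x w + g \<bullet> v + 2 * (norm v)\<^sup>2 * G"
    by (simp add: risk_def g_def inner_risk_grad G_def mean_sigm_def algebra_simps)
  also have "g \<bullet> v = - eta * (norm g)\<^sup>2"
    by (simp add: v_def power2_norm_eq_inner)
  also have "2 * (norm v)\<^sup>2 * G = 2 * (eta * G) * (eta * (norm g)\<^sup>2)"
    by (simp add: nv power2_eq_square)
  also have "\<dots> \<le> 2 * (1/8) * (eta * (norm g)\<^sup>2)"
    using G eta by (intro mult_right_mono) auto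
  finally show ?thesis by (simp add: v_def g_def algebra_simps)
qed

text \<open>One misclassified point alone has loss at least 1/2, while all losses together sum to at
  most \<open>n / (8 * eta) <= 1/8\<close>.\<close>

lemma margin_pos_if_risk_small:
  assumes n: "n \<ge> 1" and eta: "real n \<le> eta" and small: "risk n x w \<le> 1 / (8 * eta)" and i: "i < n"
  shows "0 < w \<bullet> x i"
proof (rule ccontr)
  assume "\<not> 0 < w \<bullet> x i"
  then have "1/2 \<le> logloss (w \<bullet> x i)"
    using sigm_ge_half sigm_le_logloss order_trans by (meson linorder_not_less)
  also have "\<dots> \<le> (\<Sum>j<n. logloss (w \<bullet> x j))"
    using i by (intro member_le_sum) (auto intro: less_imp_le[OF logloss_pos])
  also have "\<dots> = real n * risk n x w" using n by (simp add: risk_def)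
  also have "\<dots> \<le> real n * (1 / (8 * eta))" using small by (intro mult_left_mono) auto
  also have "\<dots> \<le> 1/8" using n eta by (simp add: divide_simps)
  finally show False by simp
qed

text \<open>With all margins positive the risk is at most twice the mean weight, and testing the
  gradient against \<open>p\<close> gives \<open>c * mean_sigm <= norm (risk_grad)\<close>. Hence
  the gradient norm is at least \<open>c * risk / 2\<close>, which is inserted into
  \<open>risk_descent\<close>.\<close>

lemma risk_stable_step:
  assumes n: "n \<ge> 1" and x: "\<And>i. i < n \<Longrightarrow> norm (x i) \<le> 1" and eta: "real n \<le> eta"
    and small: "risk n x w \<le> 1 / (8 * eta)"
    and p: "norm p = 1" and c: "0 < c" "\<And>i. i < n \<Longrightarrow> c \<le> p \<bullet> x i"
  shows "risk n x (w - eta *\<^sub>R risk_grad n x w)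
    \<le> risk n x w - eta * c\<^sup>2 / 8 * (risk n x w)\<^sup>2"
proof -
  have eta0: "0 < eta" using n eta by linarith
  have "risk n x w \<le> 2 * mean_sigm n x w"
  proof -
    have "(\<Sum>i<n. logloss (w \<bullet> x i)) \<le> (\<Sum>i<n. 2 * sigm (w \<bullet> x i))"
      using margin_pos_if_risk_small[OF n eta small] by (intro sum_mono logloss_le_2_sigm) fastforce
    then show ?thesis
      by (simp add: risk_def mean_sigm_def divide_right_mono flip: sum_distrib_left)
  qed
  moreover have "c * mean_sigm n x w \<le> norm (risk_grad n x w)"
  proof -
    have "c * mean_sigm n x w = (1 / real n) * (\<Sum>i<n. sigm (w \<bullet> x i) * c)"
      by (simp add: mean_sigm_def mult.commute flip: sum_distrib_left)
    also have "\<dots> \<le> (1 / real n) * (\<Sum>i<n. sigm (w \<bullet> x i) * (x i \<bullet> p))"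
      using c(2) sigm_pos
      by (intro mult_left_mono sum_mono) (auto simp: inner_commute less_imp_le)
    also have "\<dots> \<le> \<bar>risk_grad n x w \<bullet> p\<bar>"
      by (simp add: inner_risk_grad divide_right_mono)
    also have "\<dots> \<le> norm (risk_grad n x w)"
      using Cauchy_Schwarz_ineq2[of "risk_grad n x w" p] p by simp
    finally show ?thesis .
  qed
  ultimately have "c * risk n x w / 2 \<le> norm (risk_grad n x w)"
    using c(1) by (smt (verit) mult_left_mono field_sum_of_halves mult_2 distrib_left)
  then have "(c * risk n x w / 2)\<^sup>2 \<le> (norm (risk_grad n x w))\<^sup>2"
    using c(1) risk_pos[OF n, of x w] by (intro power_mono) auto
  then have "3/4 * eta * (c * risk n x w / 2)\<^sup>2 \<le> 3/4 * eta * (norm (risk_grad n x w))\<^sup>2"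
    using eta0 by (intro mult_left_mono) auto
  moreover have "eta * c\<^sup>2 / 8 * (risk n x w)\<^sup>2 \<le> 3/4 * eta * (c * risk n x w / 2)\<^sup>2"
    using eta0 by (simp add: power_mult_distrib power_divide)
  ultimately show ?thesis
    using risk_descent[OF n x eta0 small] by linarith
qed

text \<open>Discrete form of the passage from \<open>s' = - k * s^2\<close> to
  \<open>(1 / s)' = k\<close>; it rests on \<open>(1 - k * s) * (1 + k * s) <= 1\<close>.\<close>

lemma inverse_growth:
  fixes s r k :: real
  assumes "0 < r" "0 < s" "0 \<le> k" "r \<le> s - k * s\<^sup>2"
  shows "1 / s + k \<le> 1 / r"
proof -
  have "r * (1 + k * s) \<le> (s - k * s\<^sup>2) * (1 + k * s)"
    using assms by (intro mult_right_mono) auto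
  also have "\<dots> = s * (1 - (k * s)\<^sup>2)" by (simp add: algebra_simps power2_eq_square)
  also have "\<dots> \<le> s * 1" using assms by (intro mult_left_mono) auto
  finally show ?thesis using assms by (simp add: field_simps)
qed

text \<open>The small risk is carried through the induction because each step estimate requires it;
  the inverse risks then telescope.\<close>

lemma stable_phase:
  assumes n: "n \<ge> 1" and x: "\<And>i. i < n \<Longrightarrow> norm (x i) \<le> 1" and eta: "real n \<le> eta"
    and small: "risk n x (gd n x eta s) \<le> 1 / (8 * eta)"
    and p: "norm p = 1" and c: "0 < c" "\<And>i. i < n \<Longrightarrow> c \<le> p \<bullet> x i"
  shows "risk n x (gd n x eta (s + k)) \<le> 1 / (8 * eta) \<and>
    real k * (eta * c\<^sup>2 / 8) \<le> 1 / risk n x (gd n x eta (s + k))"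
proof (induction k)
  case 0
  then show ?case using small risk_pos[OF n] by (simp add: less_imp_le)
next
  case (Suc k)
  let ?w = "gd n x eta (s + k)" and ?w' = "gd n x eta (s + Suc k)"
  have eta0: "0 < eta" using n eta by linarith
  have step: "risk n x ?w' \<le> risk n x ?w - eta * c\<^sup>2 / 8 * (risk n x ?w)\<^sup>2"
    using risk_stable_step[OF n x eta _ p c, where w = ?w] Suc by simp
  have "0 \<le> eta * c\<^sup>2 / 8 * (risk n x ?w)\<^sup>2" using eta0 by simp
  then have "risk n x ?w' \<le> 1 / (8 * eta)" using step Suc by linarith
  moreover have "1 / risk n x ?w + eta * c\<^sup>2 / 8 \<le> 1 / risk n x ?w'"
    using step eta0 by (intro inverse_growth risk_pos[OF n]) auto
  ultimately show ?case using Suc by (simp add: algebra_simps)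
qed

text \<open>The supremum is a maximum by compactness of the sphere and continuity of the minimum
  margin. Normalising a separating vector shows it positive, and Cauchy-Schwarz bounds it by
  1.\<close>

lemma max_margin_attained:
  assumes n: "n \<ge> 1" and x: "\<And>i. i < n \<Longrightarrow> norm (x i) \<le> 1"
    and sep: "\<exists>w::real^2. \<forall>i<n. w \<bullet> x i > 0"
  obtains p where "norm p = 1" "\<And>i. i < n \<Longrightarrow> max_margin n x \<le> p \<bullet> x i"
    "0 < max_margin n x" "max_margin n x \<le> 1"
proof -
  define f where "f w = Min ((\<lambda>i. w \<bullet> x i) ` {..<n})" for w
  have ne: "{..<n} \<noteq> {}" using n by (auto simp: lessThan_empty_iff)
  have cont: "continuous_on (sphere 0 1) f"
  proof -
    have "continuous_on S (\<lambda>w. Min ((\<lambda>i. w \<bullet> x i) ` I))" if "finite I" "I \<noteq> {}"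
      for S :: "(real^2) set" and I :: "nat set"
      using that
    proof (induction rule: finite_ne_induct)
      case (insert i I)
      then have "(\<lambda>w. Min ((\<lambda>i. w \<bullet> x i) ` insert i I)) = (\<lambda>w. min (w \<bullet> x i) (Min ((\<lambda>i. w \<bullet> x i) ` I)))"
        by simp
      then show ?case using insert by (simp add: continuous_intros)
    qed (simp add: continuous_intros)
    then show ?thesis unfolding f_def using ne by simp
  qed
  obtain p where p: "p \<in> sphere 0 1" "\<And>w. w \<in> sphere 0 1 \<Longrightarrow> f w \<le> f p"
  proof -
    obtain u :: "real^2" where "norm u = 1" using vector_choose_size[of 1] by auto
    then have "sphere (0::real^2) 1 \<noteq> {}" by auto
    then show ?thesis using continuous_attains_sup[OF compact_sphere _ cont] that by blast
  qed
  have mm: "max_margin n x = f p"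
    unfolding max_margin_def f_def[symmetric] using p
    by (intro cSup_eq_maximum) auto
  obtain w :: "real^2" where w: "\<And>i. i < n \<Longrightarrow> w \<bullet> x i > 0" using sep by blast
  have "w \<noteq> 0" using w[of 0] n by auto
  then have "f (w /\<^sub>R norm w) \<le> f p" by (intro p(2)) simp
  moreover have "0 < f (w /\<^sub>R norm w)"
    unfolding f_def using ne w \<open>w \<noteq> 0\<close> by (subst Min_gr_iff) auto
  ultimately have pos: "0 < max_margin n x" using mm by linarith
  have le: "max_margin n x \<le> p \<bullet> x i" if "i < n" for i
    unfolding mm f_def using that by (intro Min_le) auto
  have "max_margin n x \<le> norm p * norm (x 0)"
    using le[of 0] n norm_cauchy_schwarz[of p "x 0"] by linarith
  also have "\<dots> \<le> 1" using p(1) x[of 0] n by simp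
  finally show ?thesis using that[of p] p(1) le pos by simp
qed

subsection \<open>Planar dynamics before the transition\<close>

text \<open>Gradient descent in an orthonormal frame: \<open>(a i, b i)\<close> are the coordinates
  of the data and \<open>(P t, Q t)\<close> those of the iterate, the first one along the maximum
  margin direction.\<close>

locale planar_gd =
  fixes n :: nat and a b :: "nat \<Rightarrow> real" and eta c :: real and P Q :: "nat \<Rightarrow> real"
  assumes n: "n \<ge> 1"
    and a_ge: "i < n \<Longrightarrow> c \<le> a i" and b_le: "i < n \<Longrightarrow> \<bar>b i\<bar> \<le> 1"
    and c_pos: "0 < c" and c_le: "c \<le> 1"
    and eta_n: "real n \<le> eta" and eta_c: "32 / c\<^sup>2 * ln (256 / c\<^sup>2) \<le> eta"
    and P_0: "P 0 = 0" and Q_0: "Q 0 = 0"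
    and P_Suc: "P (Suc t) = P t + eta / real n * (\<Sum>i<n. sigm (P t * a i + Q t * b i) * a i)"
    and Q_Suc: "Q (Suc t) = Q t + eta / real n * (\<Sum>i<n. sigm (P t * a i + Q t * b i) * b i)"
begin

definition margin :: "nat \<Rightarrow> nat \<Rightarrow> real" where
  "margin t i = P t * a i + Q t * b i"

abbreviation weight :: "nat \<Rightarrow> nat \<Rightarrow> real" where
  "weight t i \<equiv> sigm (margin t i)"

definition active :: "nat \<Rightarrow> nat set" where
  "active t = {i. i < n \<and> Q t * b i < 0}"

definition active_mean :: "nat \<Rightarrow> real" where
  "active_mean t = (1 / real n) * (\<Sum>i\<in>active t. weight t i)"

definition loss :: "nat \<Rightarrow> real" where
  "loss t = (1 / real n) * (\<Sum>i<n. logloss (margin t i))"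

text \<open>Bound for the weight and the loss of an inactive point, whose margin is at least
  \<open>eta * c^2 / 2\<close> from the first step on.\<close>

definition eps :: real where
  "eps = exp (- (eta * c\<^sup>2 / 2))"

text \<open>Time 0 is excluded because the lower bound on \<open>P\<close> holds only after the
  first step.\<close>

definition unsettled :: "nat \<Rightarrow> bool" where
  "unsettled t \<longleftrightarrow> t \<ge> 1 \<and> loss t > 1 / (8 * eta)"

section \<open>Consequences of the step size condition\<close>

lemma n_pos: "0 < real n" and eta_ge_1: "1 \<le> eta" and eta_pos: "0 < eta"
  using n eta_n by linarith+

lemma eps_pos: "0 < eps" by (simp add: eps_def)

lemma a_pos: "i < n \<Longrightarrow> 0 < a i"
  using a_ge c_pos by fastforce

lemma active_finite [simp]: "finite (active t)" by (simp add: active_def)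

lemma active_less: "i \<in> active t \<Longrightarrow> i < n" by (simp add: active_def)

lemma sum_active: "(\<Sum>i<n. f i) = (\<Sum>i\<in>active t. f i) + (\<Sum>i\<in>{..<n} - active t. f i)" for f :: "nat \<Rightarrow> real"
proof -
  have "active t \<subseteq> {..<n}" by (auto simp: active_def)
  then show ?thesis by (metis add.commute finite_lessThan sum.subset_diff)
qed

text \<open>With \<open>E = exp (eta * c^2 / 32)\<close> the step size condition reads
  \<open>256 / c^2 <= E\<close>. Together with \<open>eta * c^2 <= 32 * E\<close> it gives
  \<open>8 * eta <= E^2\<close>. Since \<open>eps = 1 / E^16\<close>, the powers of \<open>E\<close>
  needed to dominate \<open>eta^2\<close> and \<open>1 / c^4\<close> are available.\<close>

lemma
  shows eta_le_exp: "8 * eta \<le> exp (eta * c\<^sup>2 / 16)"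
    and eps_le: "eta\<^sup>2 * eps \<le> c ^ 4 / 1000"
proof -
  define E where "E = exp (eta * c\<^sup>2 / 32)"
  have c2: "0 < c\<^sup>2" "c\<^sup>2 \<le> 1" using c_pos c_le by (auto simp: power_le_one)
  have "ln (256 / c\<^sup>2) \<le> eta * c\<^sup>2 / 32"
    using eta_c c2 by (simp add: field_simps)
  then have "exp (ln (256 / c\<^sup>2)) \<le> E" by (simp add: E_def)
  then have E: "256 / c\<^sup>2 \<le> E" using c2 by simp
  then have E': "256 \<le> c\<^sup>2 * E" using c2 by (simp add: field_simps)
  have Epos: "0 < E" by (simp add: E_def)
  have E1: "1 \<le> E" using E' c2 Epos by (smt (verit) mult_left_le_one_le)
  have z: "eta * c\<^sup>2 \<le> 32 * E"
    using exp_ge_add_one_self[of "eta * c\<^sup>2 / 32"] unfolding E_def by linarith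
  have "256 * eta \<le> (c\<^sup>2 * E) * eta" using E' eta_pos by (intro mult_right_mono) auto
  also have "\<dots> \<le> (32 * E) * E"
    using mult_right_mono[OF z, of E] Epos by (simp add: mult_ac)
  finally have etaE: "8 * eta \<le> E\<^sup>2" by (simp add: power2_eq_square)
  moreover have "E\<^sup>2 = exp (eta * c\<^sup>2 / 16)"
    by (simp add: E_def flip: exp_of_nat_mult exp_double)
  ultimately show "8 * eta \<le> exp (eta * c\<^sup>2 / 16)" by simp
  have "E ^ 16 * eps = 1"
    by (simp add: E_def eps_def flip: exp_of_nat_mult exp_add)
  moreover have "E ^ 6 \<le> E ^ 16" using E1 by (intro power_increasing) auto
  ultimately have E6: "E ^ 6 * eps \<le> 1"
    using mult_right_mono[of "E ^ 6" "E ^ 16" eps] eps_pos by linarith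
  have "256\<^sup>2 \<le> (c\<^sup>2 * E)\<^sup>2" using E' by (intro power_mono) auto
  then have c4: "256\<^sup>2 \<le> c ^ 4 * E\<^sup>2" by (simp add: power_mult_distrib flip: power_mult)
  have "(8 * eta)\<^sup>2 \<le> (E\<^sup>2)\<^sup>2" using etaE eta_pos by (intro power_mono) auto
  then have e4: "64 * eta\<^sup>2 \<le> E ^ 4" by (simp add: power_mult_distrib flip: power_mult)
  have "256\<^sup>2 * (64 * eta\<^sup>2 * eps) \<le> (c ^ 4 * E\<^sup>2) * (E ^ 4 * eps)"
    using c4 e4 eps_pos by (intro mult_mono mult_right_mono) auto
  also have "\<dots> = c ^ 4 * (E ^ 6 * eps)" by (simp add: algebra_simps flip: power_add)
  also have "\<dots> \<le> c ^ 4 * 1" using E6 by (intro mult_left_mono) auto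
  finally have 1: "256\<^sup>2 * (64 * eta\<^sup>2 * eps) \<le> c ^ 4" by simp
  have "1000 * (eta\<^sup>2 * eps) \<le> 256\<^sup>2 * (64 * eta\<^sup>2 * eps)" using eps_pos by simp
  with 1 show "eta\<^sup>2 * eps \<le> c ^ 4 / 1000" by linarith
qed

lemma power_c_le: "i \<le> j \<Longrightarrow> c ^ j \<le> c ^ i"
  using c_pos c_le by (intro power_decreasing) auto

lemma eta_eps_le: "eta * (eta * eps) \<le> c\<^sup>2 / 1000" "eta * (eta * eps) \<le> c ^ 3 / 1000" "eta * eps \<le> c\<^sup>2 / 1000"
proof -
  show 1: "eta * (eta * eps) \<le> c\<^sup>2 / 1000" "eta * (eta * eps) \<le> c ^ 3 / 1000"
    using eps_le power_c_le[of 2 4] power_c_le[of 3 4] by (auto simp: power2_eq_square mult_ac)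
  have "eta * eps \<le> eta * (eta * eps)"
    using mult_right_mono[OF eta_ge_1, of "eta * eps"] eps_pos eta_pos by simp
  then show "eta * eps \<le> c\<^sup>2 / 1000" using 1 by linarith
qed

lemma eta_eps_le_scaled:
  "eta * (eta * eps) * 32 \<le> c\<^sup>2" "eta * (eta * eps) * 64 \<le> c\<^sup>2" "eta * (eta * eps) * 4 \<le> c ^ 3"
proof -
  have "0 \<le> eta * (eta * eps)" using eta_pos eps_pos by simp
  then show "eta * (eta * eps) * 32 \<le> c\<^sup>2" "eta * (eta * eps) * 64 \<le> c\<^sup>2"
    "eta * (eta * eps) * 4 \<le> c ^ 3"
    using eta_eps_le(1,2) by linarith+
qed

section \<open>Growth of \<open>P\<close> and negligibility of the inactive points\<close>

lemma P_incr: "P (Suc t) \<ge> P t + c * (eta * active_mean t)"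
proof -
  have "c * (\<Sum>i\<in>active t. weight t i) = (\<Sum>i\<in>active t. weight t i * c)"
    by (simp add: sum_distrib_left mult.commute)
  also have "\<dots> \<le> (\<Sum>i\<in>active t. weight t i * a i)"
    by (intro sum_mono mult_left_mono less_imp_le[OF sigm_pos] a_ge) (rule active_less)
  also have "\<dots> \<le> (\<Sum>i<n. weight t i * a i)"
    by (rule sum_mono2) (auto simp: active_less less_imp_le[OF mult_pos_pos[OF sigm_pos a_pos]])
  finally have "eta / real n * (c * (\<Sum>i\<in>active t. weight t i)) \<le> eta / real n * (\<Sum>i<n. weight t i * a i)"
    using eta_pos by (intro mult_left_mono) auto
  then show ?thesis by (simp add: P_Suc active_mean_def margin_def mult_ac)
qed

lemma active_mean_nonneg: "0 \<le> active_mean t"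
  by (simp add: active_mean_def sum_nonneg less_imp_le[OF sigm_pos])

lemma active_mean_le_1: "active_mean t \<le> 1"
proof -
  have "(\<Sum>i\<in>active t. weight t i) \<le> (\<Sum>i<n. 1)"
    by (rule order_trans[OF sum_mono[of _ _ "\<lambda>_. 1"] sum_mono2]) (auto simp: sigm_le_1 active_less)
  then show ?thesis using n_pos by (simp add: active_mean_def)
qed

lemma P_mono: "P t \<le> P (Suc t)"
proof -
  have "0 \<le> c * (eta * active_mean t)" using c_pos eta_pos active_mean_nonneg by simp
  then show ?thesis using P_incr[of t] by linarith
qed

text \<open>At the origin every weight is \<open>sigm 0 = 1/2\<close>, so the first step alone gives
  the bound; monotonicity preserves it.\<close>

lemma P_ge:
  assumes "t \<ge> 1"
  shows "eta * c / 2 \<le> P t"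
proof -
  have "(\<Sum>i<n. c / 2) \<le> (\<Sum>i<n. sigm 0 * a i)"
    using a_ge by (intro sum_mono) (simp add: sigm_def)
  then have "eta / real n * (\<Sum>i<n. c / 2) \<le> eta / real n * (\<Sum>i<n. sigm 0 * a i)"
    using eta_pos by (intro mult_left_mono) auto
  also have "\<dots> = P (Suc 0)" by (simp add: P_Suc P_0 Q_0)
  finally have "eta / real n * (\<Sum>i<n. c / 2) \<le> P (Suc 0)" .
  then have "eta * c / 2 \<le> P 1" using n_pos by simp
  also have "P 1 \<le> P t" using assms P_mono by (rule lift_Suc_mono_le[rotated])
  finally show ?thesis .
qed

lemma P_pos: "t \<ge> 1 \<Longrightarrow> 0 < P t"
  using P_ge[of t] eta_pos c_pos by (smt (verit) half_gt_zero mult_pos_pos)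

lemma Pa_ge:
  assumes "t \<ge> 1" "i < n"
  shows "eta * c\<^sup>2 / 2 \<le> P t * a i"
proof -
  have "(eta * c / 2) * c \<le> P t * a i"
    using P_ge[OF assms(1)] a_ge[OF assms(2)] P_pos[OF assms(1)] c_pos by (intro mult_mono) auto
  then show ?thesis by (simp add: power2_eq_square)
qed

lemma inactive_le:
  assumes "t \<ge> 1" "i < n" "i \<notin> active t"
  shows "weight t i \<le> eps" "logloss (margin t i) \<le> eps"
proof -
  have "eta * c\<^sup>2 / 2 \<le> margin t i"
    using assms Pa_ge[OF assms(1,2)] by (auto simp: active_def margin_def)
  then have "exp (- margin t i) \<le> eps" by (simp add: eps_def)
  then show "weight t i \<le> eps" "logloss (margin t i) \<le> eps"
    using sigm_le_exp logloss_le_exp order_trans by blast+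
qed

lemma inactive_sum_le:
  assumes "t \<ge> 1" "\<And>i. i < n \<Longrightarrow> \<bar>k i\<bar> \<le> 1"
  shows "\<bar>\<Sum>i\<in>{..<n} - active t. weight t i * k i\<bar> \<le> real n * eps"
proof -
  have "\<bar>\<Sum>i\<in>{..<n} - active t. weight t i * k i\<bar> \<le> (\<Sum>i\<in>{..<n} - active t. eps)"
  proof (rule order_trans[OF sum_abs sum_mono])
    fix i assume "i \<in> {..<n} - active t"
    then show "\<bar>weight t i * k i\<bar> \<le> eps"
      using mult_mono[OF inactive_le(1)[OF assms(1), of i] assms(2)[of i]] eps_pos sigm_pos[of "margin t i"]
      by (simp add: abs_mult)
  qed
  also have "\<dots> \<le> (\<Sum>i<n. eps)" using eps_pos by (intro sum_mono2) auto
  finally show ?thesis by simp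
qed

section \<open>Iterates whose loss exceeds the threshold\<close>

lemma active_exists:
  assumes "unsettled t"
  obtains i where "i \<in> active t" "7/8 * (P t * a i) \<le> \<bar>Q t\<bar> * \<bar>b i\<bar>" "1 / (16 * eta) \<le> weight t i"
proof -
  have t: "t \<ge> 1" and Rt: "loss t > 1 / (8 * eta)" using assms by (auto simp: unsettled_def)
  \<comment> \<open>Some point has loss above the average threshold. Since \<open>eps\<close> lies
    below that threshold, the point must be active.\<close>
  obtain i where i: "i < n" "1 / (8 * eta) < logloss (margin t i)"
  proof (rule ccontr)
    assume "\<not> thesis"
    then have "(\<Sum>i<n. logloss (margin t i)) \<le> (\<Sum>i<n. 1 / (8 * eta))"
      using that by (intro sum_mono) force
    then have "loss t \<le> (1 / real n) * (\<Sum>i<n. 1 / (8 * eta))"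
      unfolding loss_def by (intro mult_left_mono) auto
    then show False using Rt n_pos by simp
  qed
  have e: "1 / (8 * eta) < exp (- margin t i)" using i(2) logloss_le_exp[of "margin t i"] by linarith
  have iA: "i \<in> active t"
  proof (rule ccontr)
    assume "i \<notin> active t"
    then have "1 / (8 * eta) < eps" using inactive_le(2)[OF t i(1)] i(2) by linarith
    then have "1 < 8 * (eta * eps)" using eta_pos by (simp add: field_simps)
    moreover have "c\<^sup>2 \<le> 1" using c_pos c_le by (simp add: power_le_one)
    ultimately show False using eta_eps_le(3) by linarith
  qed
  have "exp (margin t i) < 8 * eta" using e eta_pos by (simp add: exp_minus field_simps)
  then have "exp (margin t i) < exp (eta * c\<^sup>2 / 16)" using eta_le_exp by linarith
  \<comment> \<open>The margin is below an eighth of its \<open>P\<close> part, so the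
    \<open>Q\<close> part cancels the remaining seven eighths.\<close>
  then have mi: "margin t i < P t * a i / 8" using Pa_ge[OF t i(1)] by simp
  have "Q t * b i = - (\<bar>Q t\<bar> * \<bar>b i\<bar>)" using iA by (simp add: active_def flip: abs_mult)
  then have 1: "7/8 * (P t * a i) \<le> \<bar>Q t\<bar> * \<bar>b i\<bar>" using mi unfolding margin_def by linarith
  have 2: "1 / (16 * eta) \<le> weight t i"
  proof (cases "margin t i \<le> 0")
    case True
    have "1 / (16 * eta) \<le> 1 / 2" using eta_ge_1 by (simp add: divide_simps)
    then show ?thesis using sigm_ge_half[OF True] by linarith
  next
    case False
    then show ?thesis using exp_le_2_sigm[of "margin t i"] e by simp
  qed
  show thesis using that iA 1 2 .
qed

lemma Q_ge:
  assumes "unsettled t"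
  shows "c * P t / 2 \<le> \<bar>Q t\<bar>"
proof -
  obtain i where i: "i \<in> active t" "7/8 * (P t * a i) \<le> \<bar>Q t\<bar> * \<bar>b i\<bar>" using active_exists[OF assms] .
  have P: "0 < P t" using assms P_pos by (simp add: unsettled_def)
  have "c * P t \<le> P t * a i" using a_ge[OF active_less[OF i(1)]] P by (simp add: mult.commute)
  moreover have "\<bar>Q t\<bar> * \<bar>b i\<bar> \<le> \<bar>Q t\<bar>"
    using b_le[OF active_less[OF i(1)]] by (simp add: mult_left_le)
  moreover have "0 < c * P t" using P c_pos by simp
  ultimately show ?thesis using i(2) by linarith
qed

text \<open>A single weight of \<open>1 / (16 * eta)\<close> averaged over \<open>n <= eta\<close>
  points leaves \<open>1 / (16 * eta^2)\<close>; this is why \<open>eps\<close> has to be small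
  against \<open>1 / eta^2\<close>.\<close>

lemma active_mean_ge:
  assumes "unsettled t"
  shows "0 < active_mean t" "eps \<le> c\<^sup>2 / 2 * active_mean t"
proof -
  obtain i where i: "i \<in> active t" "1 / (16 * eta) \<le> weight t i" using active_exists[OF assms] .
  have "1 / (16 * eta) \<le> (\<Sum>i\<in>active t. weight t i)"
    using i member_le_sum[of i "active t" "weight t"] less_imp_le[OF sigm_pos] by force
  then have "(1 / real n) * (1 / (16 * eta)) \<le> active_mean t"
    unfolding active_mean_def by (intro mult_left_mono) auto
  moreover have "(1 / eta) * (1 / (16 * eta)) \<le> (1 / real n) * (1 / (16 * eta))"
    using n_pos eta_n eta_pos by (intro mult_right_mono) (auto simp: frac_le)
  ultimately have active_mean: "1 / (16 * eta\<^sup>2) \<le> active_mean t" by (simp add: power2_eq_square)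
  then show "0 < active_mean t" using eta_pos by (smt (verit) divide_pos_pos zero_less_power)
  have "eps \<le> c\<^sup>2 / 2 * (1 / (16 * eta\<^sup>2))"
    using eta_eps_le_scaled(1) eta_pos
    by (simp add: pos_le_divide_eq power2_eq_square[of eta] mult_ac)
  also have "\<dots> \<le> c\<^sup>2 / 2 * active_mean t" using active_mean by (intro mult_left_mono) auto
  finally show "eps \<le> c\<^sup>2 / 2 * active_mean t" .
qed

section \<open>Motion of the orthogonal coordinate \<open>Q\<close>\<close>

definition pull :: "nat \<Rightarrow> real" where
  "pull t = eta / real n * (\<Sum>i\<in>active t. weight t i * \<bar>b i\<bar>)"

text \<open>Active points have \<open>b i\<close> of sign opposite to \<open>Q t\<close>, so after
  multiplication by \<open>sgn (Q t)\<close> their contribution is exactly \<open>- pull t\<close>;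
  the inactive points account for the error.\<close>

lemma Q_step:
  assumes "unsettled t"
  shows "\<bar>sgn (Q t) * Q (Suc t) - (\<bar>Q t\<bar> - pull t)\<bar> \<le> eta * eps"
proof -
  have t: "t \<ge> 1" using assms by (simp add: unsettled_def)
  define S where "S = (\<Sum>i\<in>{..<n} - active t. weight t i * (sgn (Q t) * b i))"
  have act: "(\<Sum>i\<in>active t. weight t i * (sgn (Q t) * b i)) = - (\<Sum>i\<in>active t. weight t i * \<bar>b i\<bar>)"
    unfolding sum_negf[symmetric]
    by (rule sum.cong) (auto simp: active_def mult_less_0_iff)
  have "sgn (Q t) * (\<Sum>i<n. weight t i * b i) = (\<Sum>i<n. weight t i * (sgn (Q t) * b i))"
    by (simp add: sum_distrib_left mult_ac)
  also have "\<dots> = S - (\<Sum>i\<in>active t. weight t i * \<bar>b i\<bar>)"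
    unfolding sum_active[of _ t] act S_def by simp
  finally have s: "sgn (Q t) * (\<Sum>i<n. weight t i * b i) = S - (\<Sum>i\<in>active t. weight t i * \<bar>b i\<bar>)" .
  have "sgn (Q t) * Q (Suc t) = sgn (Q t) * Q t + eta / real n * (sgn (Q t) * (\<Sum>i<n. weight t i * b i))"
    by (simp add: Q_Suc margin_def algebra_simps)
  also have "sgn (Q t) * Q t = \<bar>Q t\<bar>" by (metis abs_sgn mult.commute)
  finally have eq: "sgn (Q t) * Q (Suc t) - (\<bar>Q t\<bar> - pull t) = eta / real n * S"
    by (simp add: s pull_def right_diff_distrib)
  have "\<bar>S\<bar> \<le> real n * eps"
    unfolding S_def using b_le by (intro inactive_sum_le t) (auto simp: abs_mult sgn_if)
  then have "eta / real n * \<bar>S\<bar> \<le> eta / real n * (real n * eps)"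
    using eta_pos by (intro mult_left_mono) auto
  then show ?thesis unfolding eq using n_pos eta_pos by (simp add: abs_mult)
qed

lemma pull_le: "pull t \<le> eta * active_mean t"
proof -
  have "(\<Sum>i\<in>active t. weight t i * \<bar>b i\<bar>) \<le> (\<Sum>i\<in>active t. weight t i)"
    using b_le active_less less_imp_le[OF sigm_pos] by (intro sum_mono mult_left_le) auto
  then have "eta / real n * (\<Sum>i\<in>active t. weight t i * \<bar>b i\<bar>) \<le> eta / real n * (\<Sum>i\<in>active t. weight t i)"
    using eta_pos by (intro mult_left_mono) auto
  then show ?thesis by (simp add: pull_def active_mean_def)
qed

text \<open>The inactive error cannot outweigh the pull: for the point from
  \<open>active_exists\<close>, \<open>\<bar>Q t\<bar> <= eta\<close> forces
  \<open>\<bar>b i\<bar> >= c^2 / 4\<close>, so its contribution alone suffices.\<close>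

lemma pull_ge:
  assumes u: "unsettled t" and Q: "\<bar>Q t\<bar> \<le> eta"
  shows "eta * eps \<le> pull t"
proof -
  obtain i where i: "i \<in> active t" "7/8 * (P t * a i) \<le> \<bar>Q t\<bar> * \<bar>b i\<bar>" "1 / (16 * eta) \<le> weight t i"
    using active_exists[OF u] .
  have t: "t \<ge> 1" using u by (simp add: unsettled_def)
  have "\<bar>Q t\<bar> * \<bar>b i\<bar> \<le> eta * \<bar>b i\<bar>" using Q by (intro mult_right_mono) auto
  moreover have "0 \<le> eta * c\<^sup>2" using eta_pos by simp
  ultimately have "eta * (c\<^sup>2 / 4) \<le> eta * \<bar>b i\<bar>"
    using Pa_ge[OF t active_less[OF i(1)]] i(2) by linarith
  then have bi: "c\<^sup>2 / 4 \<le> \<bar>b i\<bar>" using eta_pos by simp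
  have "1 / (16 * eta) * (c\<^sup>2 / 4) \<le> weight t i * \<bar>b i\<bar>"
    using i(3) bi by (intro mult_mono) (auto intro: less_imp_le[OF sigm_pos])
  also have "\<dots> \<le> (\<Sum>i\<in>active t. weight t i * \<bar>b i\<bar>)"
    using i(1) less_imp_le[OF sigm_pos] by (intro member_le_sum) auto
  finally have S: "1 / (16 * eta) * (c\<^sup>2 / 4) \<le> (\<Sum>i\<in>active t. weight t i * \<bar>b i\<bar>)" .
  have "eta * eps \<le> 1 * (1 / (16 * eta) * (c\<^sup>2 / 4))"
    using eta_eps_le_scaled(2) eta_pos by (simp add: pos_le_divide_eq mult_ac)
  also have "\<dots> \<le> eta / real n * (1 / (16 * eta) * (c\<^sup>2 / 4))"
    using n_pos eta_n eta_pos by (intro mult_right_mono) auto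
  also have "\<dots> \<le> pull t"
    unfolding pull_def using S eta_pos by (intro mult_left_mono) auto
  finally show ?thesis .
qed

text \<open>The pull absorbs the inactive error, so \<open>\<bar>Q\<bar>\<close> cannot increase
  without a change of sign; after an overshoot it is at most the pull, hence at most
  \<open>eta\<close>.\<close>

lemma Q_le:
  assumes "t \<ge> 1" "\<And>s. 1 \<le> s \<Longrightarrow> s < t \<Longrightarrow> unsettled s"
  shows "\<bar>Q t\<bar> \<le> eta"
  using assms
proof (induction t rule: nat_induct_at_least)
  case base
  have "\<bar>\<Sum>i<n. sigm 0 * b i\<bar> \<le> (\<Sum>i<n. 1)"
    using b_le by (intro order_trans[OF sum_abs sum_mono]) (fastforce simp: sigm_def)
  then have "eta / real n * \<bar>\<Sum>i<n. sigm 0 * b i\<bar> \<le> eta / real n * real n"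
    using eta_pos by (intro mult_left_mono) auto
  then show ?case
    using Q_Suc[of 0] n_pos eta_pos by (simp add: Q_0 P_0 abs_mult)
next
  case (Suc t)
  have u: "unsettled t" and IH: "\<bar>Q t\<bar> \<le> eta" using Suc by auto
  have "c * (eta * c / 2) \<le> c * P t" using P_ge Suc(1) c_pos by (intro mult_left_mono) auto
  then have "eta * c\<^sup>2 / 4 \<le> \<bar>Q t\<bar>" using Q_ge[OF u] by (simp add: power2_eq_square mult_ac)
  moreover have "eta * eps \<le> c\<^sup>2 / 4" using eta_eps_le(3) zero_le_power2[of c] by linarith
  moreover have "c\<^sup>2 \<le> eta * c\<^sup>2" using eta_ge_1 by (simp add: mult_le_cancel_right1)
  ultimately have "eta * eps \<le> \<bar>Q t\<bar>" by linarith
  moreover have "pull t \<le> eta"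
    using pull_le[of t] active_mean_le_1[of t] eta_pos by (smt (verit) mult_left_le)
  ultimately have "\<bar>sgn (Q t) * Q (Suc t)\<bar> \<le> eta"
    using Q_step[OF u] pull_ge[OF u IH] IH by linarith
  moreover have "Q t \<noteq> 0"
    using Q_ge[OF u] P_pos[of t] Suc(1) c_pos by (smt (verit) mult_pos_pos half_gt_zero)
  ultimately show ?case by (simp add: abs_mult abs_sgn_eq)
qed

section \<open>Growth of the active margins\<close>

lemma margin_step:
  assumes u: "unsettled t" and i: "i \<in> active t" and k: "\<And>j. j \<in> active t \<Longrightarrow> k j \<le> a i * a j + b i * b j"
  shows "margin t i + eta / real n * (\<Sum>j\<in>active t. weight t j * k j) - eta * eps \<le> margin (Suc t) i"
proof -
  have t: "t \<ge> 1" using u by (simp add: unsettled_def)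
  have iln: "i < n" using i active_less by blast
  \<comment> \<open>\<open>a i * a j + b i * b j\<close> is the inner product of two data points,
    and \<open>k\<close> is a lower bound for it on active pairs. For inactive \<open>j\<close> the
    product of the \<open>a\<close> is positive and dropped, and the product of the \<open>b\<close>
    is a negligible error.\<close>
  have "(\<Sum>j\<in>active t. weight t j * k j) \<le> (\<Sum>j\<in>active t. weight t j * (a i * a j + b i * b j))"
    using k less_imp_le[OF sigm_pos] by (intro sum_mono mult_left_mono) auto
  moreover have "(\<Sum>j\<in>{..<n} - active t. weight t j * (b i * b j)) \<le> (\<Sum>j\<in>{..<n} - active t. weight t j * (a i * a j + b i * b j))"
    using a_pos[OF iln] a_pos less_imp_le[OF sigm_pos] by (intro sum_mono mult_left_mono) (auto intro: less_imp_le)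
  moreover have "\<bar>\<Sum>j\<in>{..<n} - active t. weight t j * (b i * b j)\<bar> \<le> real n * eps"
    using b_le[OF iln] b_le by (intro inactive_sum_le[OF t]) (auto simp: abs_mult mult_le_one)
  ultimately have "(\<Sum>j\<in>active t. weight t j * k j) - real n * eps \<le> (\<Sum>j<n. weight t j * (a i * a j + b i * b j))"
    unfolding sum_active[of _ t] by linarith
  then have "eta / real n * ((\<Sum>j\<in>active t. weight t j * k j) - real n * eps)
      \<le> eta / real n * (\<Sum>j<n. weight t j * (a i * a j + b i * b j))"
    using eta_pos by (intro mult_left_mono) auto
  moreover have "margin (Suc t) i = margin t i + eta / real n * (\<Sum>j<n. weight t j * (a i * a j + b i * b j))"
  proof -
    have "(\<Sum>j<n. weight t j * (a i * a j + b i * b j)) = (\<Sum>j<n. weight t j * a j * a i + weight t j * b j * b i)"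
      by (simp add: algebra_simps)
    also have "\<dots> = (\<Sum>j<n. weight t j * a j) * a i + (\<Sum>j<n. weight t j * b j) * b i"
      by (simp add: sum_distrib_right sum.distrib)
    finally have s: "(\<Sum>j<n. weight t j * (a i * a j + b i * b j)) = \<dots>" .
    show ?thesis
      unfolding s margin_def[of "Suc t"] P_Suc Q_Suc margin_def[of t, symmetric]
      by (simp add: margin_def algebra_simps)
  qed
  ultimately show ?thesis using n_pos by (simp add: algebra_simps)
qed

text \<open>Dimension two enters here: the component orthogonal to the margin direction is a single
  number, of the same sign for all active points, so active points never lower each other's
  margins.\<close>

lemma b_mult_nonneg: "i \<in> active t \<Longrightarrow> j \<in> active t \<Longrightarrow> 0 \<le> b i * b j"
  by (auto simp: active_def mult_less_0_iff zero_le_mult_iff)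

text \<open>Use \<open>k = c^2\<close> in \<open>margin_step\<close>; half of the gain pays for the
  inactive error.\<close>

lemma margin_incr:
  assumes u: "unsettled t" and i: "i \<in> active t"
  shows "margin t i + eta * c\<^sup>2 / 2 * active_mean t \<le> margin (Suc t) i"
proof -
  have "c\<^sup>2 \<le> a i * a j + b i * b j" if "j \<in> active t" for j
  proof -
    have "c * c \<le> a i * a j"
      using a_ge[OF active_less[OF i]] a_ge[OF active_less[OF that]] c_pos by (intro mult_mono) auto
    then show ?thesis using b_mult_nonneg[OF i that] by (simp add: power2_eq_square)
  qed
  from margin_step[OF u i, of "\<lambda>_. c\<^sup>2", OF this]
  have "margin t i + eta * c\<^sup>2 * active_mean t - eta * eps \<le> margin (Suc t) i"
    by (simp add: active_mean_def mult_ac flip: sum_distrib_left)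
  moreover have "eta * eps \<le> eta * (c\<^sup>2 / 2 * active_mean t)"
    using active_mean_ge(2)[OF u] eta_pos by (intro mult_left_mono) auto
  ultimately show ?thesis by (simp add: algebra_simps)
qed

lemma margin_mono:
  assumes "unsettled t" "i \<in> active t"
  shows "margin t i \<le> margin (Suc t) i"
  using margin_incr[OF assms] active_mean_nonneg[of t] eta_pos by (smt (verit) mult_nonneg_nonneg zero_le_power2 divide_nonneg_pos)

text \<open>The point's own weight is at least 1/2, and its diagonal term alone yields
  \<open>eta * c * \<bar>b i\<bar> / n\<close>. Being misclassified while
  \<open>\<bar>Q t\<bar> <= eta\<close> forces \<open>\<bar>b i\<bar> >= c^2 / 2\<close>, so the
  inactive error takes at most half of this.\<close>

lemma margin_incr_misclassified:
  assumes u: "unsettled t" and i: "i \<in> active t" and neg: "margin t i < 0" and Q: "\<bar>Q t\<bar> \<le> eta"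
  shows "margin t i + eta * c * \<bar>b i\<bar> / (2 * real n) \<le> margin (Suc t) i"
proof -
  have t: "t \<ge> 1" using u by (simp add: unsettled_def)
  have iln: "i < n" using i active_less by blast
  have "Q t * b i = - (\<bar>Q t\<bar> * \<bar>b i\<bar>)" using i by (simp add: active_def flip: abs_mult)
  then have "eta * c\<^sup>2 / 2 \<le> \<bar>Q t\<bar> * \<bar>b i\<bar>" using Pa_ge[OF t iln] neg unfolding margin_def by linarith
  also have "\<dots> \<le> eta * \<bar>b i\<bar>" using Q by (intro mult_right_mono) auto
  finally have "eta * (c\<^sup>2 / 2) \<le> eta * \<bar>b i\<bar>" by simp
  then have bi: "c\<^sup>2 / 2 \<le> \<bar>b i\<bar>" using eta_pos by simp
  have "real n * eps \<le> eta * (eta * eps)"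
    using eta_n eta_ge_1 eps_pos mult_mono[of "real n" eta eps "eta * eps"] by (simp add: mult_le_cancel_right1)
  also have "\<dots> \<le> c * (c\<^sup>2 / 2) / 2"
    using eta_eps_le_scaled(3) by (simp add: power3_eq_cube power2_eq_square)
  also have "\<dots> \<le> c * \<bar>b i\<bar> / 2" using bi c_pos by (intro divide_right_mono mult_left_mono) auto
  finally have e: "eta / real n * (real n * eps) \<le> eta / real n * (c * \<bar>b i\<bar> / 2)"
    using eta_pos by (intro mult_left_mono) auto
  \<comment> \<open>By AM-GM, \<open>a\<^sup>2 + b\<^sup>2 \<ge> 2 c \<bar>b\<bar>\<close>; linear in \<open>\<bar>b\<bar>\<close> just like the largest possible violation \<open>\<eta> \<bar>b\<bar>\<close>.\<close>
  define k where "k j = (if j = i then 2 * (c * \<bar>b i\<bar>) else 0)" for j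
  have "k j \<le> a i * a j + b i * b j" if "j \<in> active t" for j
  proof (cases "j = i")
    case True
    have "0 \<le> (a i - \<bar>b i\<bar>)\<^sup>2" by simp
    then have "2 * (a i * \<bar>b i\<bar>) \<le> a i * a i + b i * b i"
      by (simp add: power2_eq_square algebra_simps flip: abs_mult)
    moreover have "c * \<bar>b i\<bar> \<le> a i * \<bar>b i\<bar>" using a_ge[OF iln] by (intro mult_right_mono) auto
    ultimately show ?thesis using True by (simp add: k_def)
  next
    case False
    then show ?thesis
      using b_mult_nonneg[OF i that] a_pos[OF iln] a_pos[OF active_less[OF that]] by (simp add: k_def)
  qed
  from margin_step[OF u i, of k, OF this]
  have 1: "margin t i + eta / real n * (weight t i * (2 * (c * \<bar>b i\<bar>))) - eta * eps \<le> margin (Suc t) i"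
    using i by (simp add: k_def if_distrib[of "\<lambda>y. _ * y"] sum.delta cong: if_cong)
  have "1/2 * (2 * (c * \<bar>b i\<bar>)) \<le> weight t i * (2 * (c * \<bar>b i\<bar>))"
    using sigm_ge_half[of "margin t i"] neg c_pos by (intro mult_right_mono) auto
  then have "eta / real n * (c * \<bar>b i\<bar>) \<le> eta / real n * (weight t i * (2 * (c * \<bar>b i\<bar>)))"
    using eta_pos by (intro mult_left_mono) auto
  moreover have "eta / real n * (c * \<bar>b i\<bar>) = 2 * (eta * c * \<bar>b i\<bar> / (2 * real n))"
     "eta / real n * (c * \<bar>b i\<bar> / 2) = eta * c * \<bar>b i\<bar> / (2 * real n)"
     "eta / real n * (real n * eps) = eta * eps"
    using n_pos by (auto simp: field_simps)
  ultimately show ?thesis using 1 e by linarith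
qed

section \<open>Sign changes of \<open>Q\<close>\<close>

lemma active_Suc:
  assumes "0 < Q t * Q (Suc t)"
  shows "active (Suc t) = active t"
  using assms by (auto simp: active_def zero_less_mult_iff mult_less_0_iff)

lemma active_mean_antimono_step:
  assumes "unsettled t" "0 < Q t * Q (Suc t)"
  shows "active_mean (Suc t) \<le> active_mean t"
  unfolding active_mean_def active_Suc[OF assms(2)]
  using margin_mono[OF assms(1)] by (intro mult_left_mono sum_mono sigm_antimono) auto

lemma active_mean_antimono:
  assumes "s \<le> k" "\<And>t. s \<le> t \<Longrightarrow> t < k \<Longrightarrow> unsettled t \<and> 0 < Q t * Q (Suc t)"
  shows "active_mean k \<le> active_mean s"
  using assms
proof (induction k rule: dec_induct)
  case (step k)
  then show ?case using active_mean_antimono_step[of k] by fastforce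
qed simp

text \<open>To cross zero, \<open>Q\<close> must be displaced by at least
  \<open>\<bar>Q t\<bar> >= c * P t / 2\<close>, whereas pull and inactive error together are at
  most \<open>2 * eta * active_mean t\<close>.\<close>

lemma active_mean_ge_crossing:
  assumes u: "unsettled t" and cross: "Q t * Q (Suc t) \<le> 0"
  shows "c * P t / 4 \<le> eta * active_mean t"
proof -
  have "sgn (Q t) * Q (Suc t) \<le> 0"
    using cross by (auto simp: sgn_if mult_le_0_iff)
  then have "\<bar>Q t\<bar> \<le> pull t + eta * eps" using Q_step[OF u] by linarith
  moreover have "eta * eps \<le> eta * active_mean t"
  proof -
    have "c\<^sup>2 \<le> 1" using c_pos c_le by (simp add: power_le_one)
    then have "c\<^sup>2 / 2 * active_mean t \<le> active_mean t" using active_mean_nonneg by (intro mult_left_le_one_le) auto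
    then show ?thesis using active_mean_ge(2)[OF u] eta_pos by simp
  qed
  ultimately have "\<bar>Q t\<bar> \<le> 2 * (eta * active_mean t)" using pull_le[of t] by linarith
  then show ?thesis using Q_ge[OF u] by linarith
qed

text \<open>Let \<open>l\<close> be the first crossing at or after \<open>s\<close>. No crossing
  lies between them, so \<open>active_mean\<close> does not increase from \<open>s\<close> to
  \<open>l\<close>, and its lower bound at \<open>l\<close> holds at \<open>s\<close> as well, where
  \<open>P\<close> is no larger.\<close>

lemma P_growth:
  assumes s: "1 \<le> s" "s \<le> k" and u: "\<And>t. 1 \<le> t \<Longrightarrow> t \<le> k \<Longrightarrow> unsettled t"
    and cross: "Q k * Q (Suc k) \<le> 0"
  shows "(1 + c\<^sup>2 / 4) * P s \<le> P (Suc s)"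
proof -
  define l where "l = (LEAST l. s \<le> l \<and> Q l * Q (Suc l) \<le> 0)"
  have l: "s \<le> l" "Q l * Q (Suc l) \<le> 0"
    using LeastI[of "\<lambda>l. s \<le> l \<and> Q l * Q (Suc l) \<le> 0" k] s cross by (auto simp: l_def)
  have lk: "l \<le> k" unfolding l_def using s cross by (intro Least_le) auto
  have "active_mean l \<le> active_mean s"
  proof (rule active_mean_antimono[OF l(1)])
    fix t assume t: "s \<le> t" "t < l"
    then have "\<not> (s \<le> t \<and> Q t * Q (Suc t) \<le> 0)" unfolding l_def by (intro not_less_Least) auto
    then show "unsettled t \<and> 0 < Q t * Q (Suc t)" using t lk s u by auto
  qed
  then have "eta * active_mean l \<le> eta * active_mean s" using eta_pos by simp
  moreover have "c * P l / 4 \<le> eta * active_mean l" using active_mean_ge_crossing[OF u l(2)] l(1) lk s by auto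
  moreover have "c * P s \<le> c * P l"
    using lift_Suc_mono_le[of P, OF P_mono l(1)] c_pos by simp
  ultimately have "c * P s / 4 \<le> eta * active_mean s" by linarith
  then have "c * (c * P s / 4) \<le> c * (eta * active_mean s)" using c_pos by (intro mult_left_mono) auto
  then show ?thesis using P_incr[of s] by (simp add: algebra_simps power2_eq_square)
qed

text \<open>\<open>P\<close> grows by the factor \<open>q\<close> at every step up to the crossing,
  from at least \<open>eta * c / 2\<close> to at most \<open>2 * eta / c\<close>; hence
  \<open>q^(k - 1) <= 4 / c^2\<close>, while \<open>ln q >= c^2 / 8\<close>.\<close>

lemma crossing_time_le:
  assumes k: "1 \<le> k" and u: "\<And>t. 1 \<le> t \<Longrightarrow> t \<le> k \<Longrightarrow> unsettled t"
    and cross: "Q k * Q (Suc k) \<le> 0"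
  shows "real k \<le> 1 + 8 * ln (4 / c\<^sup>2) / c\<^sup>2"
proof -
  define q where "q = 1 + c\<^sup>2 / 4"
  have c2: "0 < c\<^sup>2" "c\<^sup>2 \<le> 1" using c_pos c_le by (auto simp: power_le_one)
  have q: "1 < q" using c2 by (simp add: q_def)
  have "q ^ j * (eta * c / 2) \<le> P (Suc j)" if "j < k" for j
    using that
  proof (induction j)
    case 0
    then show ?case using P_ge[of 1] by simp
  next
    case (Suc j)
    then have "q * (q ^ j * (eta * c / 2)) \<le> q * P (Suc j)" using q by (intro mult_left_mono) auto
    also have "\<dots> \<le> P (Suc (Suc j))"
      using P_growth[OF _ _ u cross, of "Suc j"] Suc by (simp add: q_def)
    finally show ?case by (simp add: mult_ac)
  qed
  from this[of "k - 1"] have 1: "q ^ (k - 1) * (eta * c / 2) \<le> P k" using k by simp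
  have "c * P k / 2 \<le> eta" using Q_ge[OF u] Q_le[of k] u k by (smt (verit) less_imp_le order_refl)
  moreover have "c * (q ^ (k - 1) * (eta * c / 2)) \<le> c * P k" using 1 c_pos by (intro mult_left_mono) auto
  ultimately have "eta * (q ^ (k - 1) * c\<^sup>2) \<le> eta * 4" by (simp add: power2_eq_square algebra_simps)
  then have "q ^ (k - 1) \<le> 4 / c\<^sup>2" using eta_pos c2 by (simp add: pos_le_divide_eq)
  then have "ln (q ^ (k - 1)) \<le> ln (4 / c\<^sup>2)" using q by (intro ln_mono) auto
  then have 2: "real (k - 1) * ln q \<le> ln (4 / c\<^sup>2)" using q by (simp add: ln_realpow)
  have "c\<^sup>2 / 8 \<le> ln q"
  proof -
    have "- ln q \<le> inverse q - 1" using ln_le_minus_one[of "inverse q"] q by (simp add: ln_inverse)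
    moreover have "inverse q \<le> 1 - c\<^sup>2 / 8"
    proof -
      have "c\<^sup>2 * c\<^sup>2 \<le> c\<^sup>2 * 1" using c2 by (intro mult_left_mono) auto
      moreover have "(1 - c\<^sup>2 / 8) * q = 1 + c\<^sup>2 / 8 - c\<^sup>2 * c\<^sup>2 / 32"
        by (simp add: q_def algebra_simps)
      ultimately have "1 \<le> (1 - c\<^sup>2 / 8) * q" using c2 by linarith
      then show ?thesis using q by (simp add: inverse_eq_divide pos_divide_le_eq)
    qed
    ultimately show ?thesis by linarith
  qed
  then have "real (k - 1) * (c\<^sup>2 / 8) \<le> ln (4 / c\<^sup>2)"
    using 2 mult_left_mono[of "c\<^sup>2 / 8" "ln q" "real (k - 1)"] by linarith
  then have "real (k - 1) \<le> 8 * ln (4 / c\<^sup>2) / c\<^sup>2" using c2 by (simp add: pos_le_divide_eq mult_ac)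
  then show ?thesis using k by (simp add: of_nat_diff)
qed

section \<open>The phase after the last sign change\<close>

lemma active_const:
  assumes "s \<le> k" "\<And>t. s \<le> t \<Longrightarrow> t < k \<Longrightarrow> 0 < Q t * Q (Suc t)"
  shows "active k = active s"
  using assms
proof (induction k rule: dec_induct)
  case (step k)
  then show ?case using active_Suc[of k] by simp
qed simp

text \<open>The initial violation is at most \<open>eta * \<bar>b i\<bar>\<close> and shrinks by
  \<open>eta * c * \<bar>b i\<bar> / (2 * n)\<close> per step. The factor
  \<open>\<bar>b i\<bar>\<close> cancels, which makes the time uniform over the points.\<close>

lemma misclassified_time:
  assumes s: "1 \<le> s" "s \<le> N" and u: "\<And>t. 1 \<le> t \<Longrightarrow> t \<le> N \<Longrightarrow> unsettled t"
    and same: "\<And>t. s \<le> t \<Longrightarrow> t < N \<Longrightarrow> 0 < Q t * Q (Suc t)"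
    and i: "i \<in> active s" and k: "s + k \<le> N" "2 * real n / c \<le> real k"
  shows "0 \<le> margin (s + k) i"
proof (rule ccontr)
  assume neg: "\<not> 0 \<le> margin (s + k) i"
  define d where "d = eta * c * \<bar>b i\<bar> / (2 * real n)"
  have Ai: "i \<in> active (s + j)" if "s + j \<le> N" for j
    using active_const[of s "s + j"] that same i by simp
  have Q_eta: "\<bar>Q t\<bar> \<le> eta" if "1 \<le> t" "t \<le> N" for t
    using that by (intro Q_le u) auto
  \<comment> \<open>Linear growth is known only while the margin is negative. Margins are monotone,
    so a negative margin at the next step implies one at the current step.\<close>
  have "margin (s + j) i < 0 \<longrightarrow> - (eta * \<bar>b i\<bar>) + real j * d \<le> margin (s + j) i" if "s + j \<le> N" for j
    using that
  proof (induction j)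
    case 0
    have "0 < P s * a i" using P_pos[OF s(1)] a_pos[OF active_less[OF i]] by simp
    moreover have "- (\<bar>Q s\<bar> * \<bar>b i\<bar>) \<le> Q s * b i" by (simp add: abs_le_iff flip: abs_mult)
    moreover have "\<bar>Q s\<bar> * \<bar>b i\<bar> \<le> eta * \<bar>b i\<bar>" using Q_eta s by (intro mult_right_mono) auto
    ultimately show ?case by (simp add: margin_def)
  next
    case (Suc j)
    have uj: "unsettled (s + j)" using Suc.prems s by (intro u) auto
    have ij: "i \<in> active (s + j)" using Suc.prems by (intro Ai) auto
    have "margin (s + j) i \<le> margin (s + Suc j) i" using margin_mono[OF uj ij] by simp
    moreover have "margin (s + j) i + d \<le> margin (s + Suc j) i" if "margin (s + j) i < 0"
      using margin_incr_misclassified[OF uj ij that] Q_eta[of "s + j"] Suc.prems s by (simp add: d_def)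
    ultimately show ?case using Suc by (auto simp: algebra_simps)
  qed
  then have "real k * d < eta * \<bar>b i\<bar>" using neg k by force
  moreover have "eta * \<bar>b i\<bar> \<le> real k * d"
  proof -
    have "1 \<le> real k * c / (2 * real n)" using k(2) n_pos c_pos by (simp add: field_simps)
    then have "(eta * \<bar>b i\<bar>) * 1 \<le> (eta * \<bar>b i\<bar>) * (real k * c / (2 * real n))"
      using eta_pos by (intro mult_left_mono) auto
    then show ?thesis by (simp add: d_def mult_ac)
  qed
  ultimately show False by linarith
qed

text \<open>Once all active margins are nonnegative, \<open>sigm_add_le\<close> makes
  \<open>1 / active_mean\<close> grow by \<open>eta * c^2 / 4\<close> per step. An unsettled
  \<open>N\<close> has \<open>1 / (8 * eta) < loss N <= 3 * active_mean N\<close>, so this inverse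
  is at most \<open>24 * eta\<close>.\<close>

lemma soft_time:
  assumes s: "1 \<le> s" "s \<le> N" and u: "\<And>t. 1 \<le> t \<Longrightarrow> t \<le> N \<Longrightarrow> unsettled t"
    and same: "\<And>t. s \<le> t \<Longrightarrow> t < N \<Longrightarrow> 0 < Q t * Q (Suc t)"
    and correct: "\<And>i. i \<in> active s \<Longrightarrow> 0 \<le> margin s i"
  shows "real (N - s) \<le> 96 / c\<^sup>2"
proof -
  have inv: "(\<forall>i\<in>active (s + j). 0 \<le> margin (s + j) i) \<and> real j * (eta * c\<^sup>2 / 4) \<le> 1 / active_mean (s + j)"
    if "s + j \<le> N" for j
    using that
  proof (induction j)
    case 0
    then show ?case using correct active_mean_nonneg by simp
  next
    case (Suc j)
    let ?t = "s + j"
    have ut: "unsettled ?t" "unsettled (Suc ?t)" using Suc.prems s by (auto intro: u)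
    have st: "0 < Q ?t * Q (Suc ?t)" using Suc.prems by (intro same) auto
    have IH: "\<And>i. i \<in> active ?t \<Longrightarrow> 0 \<le> margin ?t i" "real j * (eta * c\<^sup>2 / 4) \<le> 1 / active_mean ?t"
      using Suc by auto
    define d where "d = eta * c\<^sup>2 / 2 * active_mean ?t"
    have d: "0 \<le> d" using eta_pos active_mean_nonneg by (simp add: d_def)
    have "weight (Suc ?t) i * (1 + d / 2) \<le> weight ?t i" if i: "i \<in> active ?t" for i
    proof -
      have "weight (Suc ?t) i \<le> sigm (margin ?t i + d)"
        using margin_incr[OF ut(1) i] by (intro sigm_antimono) (simp add: d_def)
      then have "weight (Suc ?t) i * (1 + d / 2) \<le> sigm (margin ?t i + d) * (1 + d / 2)"
        using d by (intro mult_right_mono) auto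
      also have "\<dots> \<le> weight ?t i" using IH(1)[OF i] d by (rule sigm_add_le)
      finally show ?thesis .
    qed
    then have "(\<Sum>i\<in>active ?t. weight (Suc ?t) i) * (1 + d / 2) \<le> (\<Sum>i\<in>active ?t. weight ?t i)"
      by (simp add: sum_distrib_right sum_mono)
    then have "active_mean (Suc ?t) * (1 + d / 2) \<le> active_mean ?t"
      unfolding active_mean_def active_Suc[OF st] by (simp add: divide_right_mono)
    moreover have pos: "0 < active_mean ?t" "0 < active_mean (Suc ?t)" using ut active_mean_ge(1) by auto
    ultimately have "(1 + d / 2) / active_mean ?t \<le> 1 / active_mean (Suc ?t)" by (simp add: field_simps)
    moreover have "(1 + d / 2) / active_mean ?t = 1 / active_mean ?t + eta * c\<^sup>2 / 4" using pos by (simp add: d_def field_simps)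
    ultimately have "real (Suc j) * (eta * c\<^sup>2 / 4) \<le> 1 / active_mean (Suc ?t)"
      using IH(2) by (simp add: algebra_simps)
    moreover have "\<forall>i\<in>active (Suc ?t). 0 \<le> margin (Suc ?t) i"
      unfolding active_Suc[OF st] using IH(1) margin_mono[OF ut(1)] order_trans by blast
    ultimately show ?case by simp
  qed
  have uN: "unsettled N" using u s by auto
  have N: "\<And>i. i \<in> active N \<Longrightarrow> 0 \<le> margin N i" "real (N - s) * (eta * c\<^sup>2 / 4) \<le> 1 / active_mean N"
    using inv[of "N - s"] s by auto
  have "1 / active_mean N \<le> 24 * eta"
  proof -
    have N1: "N \<ge> 1" using s by simp
    have "(\<Sum>i<n. logloss (margin N i)) \<le> (\<Sum>i\<in>active N. 2 * weight N i) + (\<Sum>i\<in>{..<n} - active N. eps)"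
      unfolding sum_active[of _ N]
      using N(1) inactive_le(2)[OF N1] by (intro add_mono sum_mono logloss_le_2_sigm) auto
    also have "(\<Sum>i\<in>{..<n} - active N. eps) \<le> (\<Sum>i<n. eps)" using eps_pos by (intro sum_mono2) auto
    finally have "(1 / real n) * (\<Sum>i<n. logloss (margin N i))
        \<le> (1 / real n) * (2 * (\<Sum>i\<in>active N. weight N i) + real n * eps)"
      by (intro mult_left_mono) (auto simp: sum_distrib_left)
    then have "loss N \<le> 2 * active_mean N + eps" using n_pos by (simp add: loss_def active_mean_def field_simps)
    moreover have "eps \<le> active_mean N"
    proof -
      have "c\<^sup>2 \<le> 1" using c_pos c_le by (simp add: power_le_one)
      then have "c\<^sup>2 / 2 * active_mean N \<le> active_mean N" using active_mean_nonneg by (intro mult_left_le_one_le) auto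
      then show ?thesis using active_mean_ge(2)[OF uN] by linarith
    qed
    ultimately have "1 / (8 * eta) \<le> 3 * active_mean N" using uN by (simp add: unsettled_def)
    then show ?thesis using active_mean_ge(1)[OF uN] eta_pos by (simp add: field_simps)
  qed
  then have "eta * (real (N - s) * c\<^sup>2) \<le> eta * 96" using N(2) by (simp add: algebra_simps)
  then show ?thesis using eta_pos c_pos by (simp add: pos_le_divide_eq)
qed

lemma last_phase_time:
  assumes s: "1 \<le> s" "s \<le> N" and u: "\<And>t. 1 \<le> t \<Longrightarrow> t \<le> N \<Longrightarrow> unsettled t"
    and same: "\<And>t. s \<le> t \<Longrightarrow> t < N \<Longrightarrow> 0 < Q t * Q (Suc t)"
  shows "real (N - s) \<le> 2 * real n / c + 1 + 96 / c\<^sup>2"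
proof -
  define k where "k = nat \<lceil>2 * real n / c\<rceil>"
  have q: "0 \<le> 2 * real n / c" "0 \<le> 96 / c\<^sup>2" using c_pos by auto
  then have k: "2 * real n / c \<le> real k" "real k \<le> 2 * real n / c + 1"
    unfolding k_def by linarith+
  show ?thesis
  proof (cases "s + k \<le> N")
    case True
    have "active (s + k) = active s" using True same by (intro active_const) auto
    then have "\<And>i. i \<in> active (s + k) \<Longrightarrow> 0 \<le> margin (s + k) i"
      using misclassified_time[OF s u same _ True k(1)] by blast
    then have "real (N - (s + k)) \<le> 96 / c\<^sup>2"
      using s True by (intro soft_time u same) auto
    then show ?thesis using k True by (simp add: of_nat_diff)
  next
    case False
    then have "real (N - s) \<le> real k" by simp
    then show ?thesis using k q by linarith
  qed
qed

lemma ln_term_nonneg: "0 \<le> 8 * ln (4 / c\<^sup>2) / c\<^sup>2"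
proof -
  have "1 \<le> 4 / c\<^sup>2" using c_pos c_le power_le_one[of c 2] by (simp add: pos_le_divide_eq)
  then have "0 \<le> ln (4 / c\<^sup>2)" by simp
  then show ?thesis by simp
qed

lemma unsettled_time:
  assumes u: "\<And>t. 1 \<le> t \<Longrightarrow> t \<le> N \<Longrightarrow> 1 / (8 * eta) < loss t"
  shows "real N \<le> 3 + 2 * real n / c + 96 / c\<^sup>2 + 8 * ln (4 / c\<^sup>2) / c\<^sup>2"
proof (cases "N = 0")
  case True
  then show ?thesis using ln_term_nonneg c_pos by simp
next
  case False
  have un: "unsettled t" if "1 \<le> t" "t \<le> N" for t
    using u that by (simp add: unsettled_def)
  \<comment> \<open>The crossings before \<open>N\<close>. The final phase starts one step after the
    last of them, or at time 1 if there is none.\<close>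
  define K where "K = {k. 1 \<le> k \<and> k < N \<and> Q k * Q (Suc k) \<le> 0}"
  obtain s where s: "1 \<le> s" "s \<le> N" "real s \<le> 2 + 8 * ln (4 / c\<^sup>2) / c\<^sup>2"
    "\<And>t. s \<le> t \<Longrightarrow> t < N \<Longrightarrow> 0 < Q t * Q (Suc t)"
  proof (cases "K = {}")
    case True
    then have "0 < Q t * Q (Suc t)" if "1 \<le> t" "t < N" for t using that by (force simp: K_def)
    then show ?thesis using that[of 1] False ln_term_nonneg by simp
  next
    case ne: False
    have fin: "finite K" by (simp add: K_def)
    define k where "k = Max K"
    have kK: "k \<in> K" using fin ne by (simp add: k_def)
    have "real k \<le> 1 + 8 * ln (4 / c\<^sup>2) / c\<^sup>2"
      using kK un by (intro crossing_time_le) (auto simp: K_def)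
    moreover have "0 < Q t * Q (Suc t)" if "Suc k \<le> t" "t < N" for t
    proof (rule ccontr)
      assume "\<not> 0 < Q t * Q (Suc t)"
      then have "t \<in> K" using that by (auto simp: K_def)
      then show False using Max_ge[OF fin, of t] that by (simp add: k_def)
    qed
    ultimately show ?thesis using that[of "Suc k"] kK by (auto simp: K_def)
  qed
  have "real (N - s) \<le> 2 * real n / c + 1 + 96 / c\<^sup>2"
    by (rule last_phase_time[OF s(1,2) un s(4)])
  then show ?thesis using s(2,3) by (simp add: of_nat_diff)
qed

end

text \<open>The terms \<open>1 / c\<^sup>2\<close> are absorbed by \<open>n / c\<close> when \<open>c \<ge> 1/2\<close> and by the
  logarithmic term otherwise.\<close>
lemma time_bound_absorb:
  assumes c: "0 < c" "c \<le> 1" and n: "n \<ge> 1"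
  shows "4 + 2 * real n / c + 96 / c\<^sup>2 + 8 * ln (4 / c\<^sup>2) / c\<^sup>2
    \<le> 300 * (real n / c + ln (1 / c) / c\<^sup>2)"
proof -
  define L where "L = ln (1 / c) / c\<^sup>2"
  define M where "M = real n / c"
  have lnc: "0 \<le> ln (1 / c)" using c by simp
  then have L: "0 \<le> L" by (simp add: L_def)
  have M1: "1 / c \<le> M" using n c by (simp add: M_def divide_right_mono)
  moreover have "1 \<le> 1 / c" using c by simp
  ultimately have M: "1 \<le> M" by linarith
  have sq: "1 / c\<^sup>2 \<le> 2 * (M + L)"
  proof (cases "c \<ge> 1/2")
    case True
    have "1 / c\<^sup>2 \<le> 2 / c" using True c by (simp add: power2_eq_square divide_simps)
    then show ?thesis using M1 L by simp
  next
    case False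
    have "ln 2 \<le> ln (1 / c)" using False c by (intro ln_mono) (auto simp: field_simps)
    moreover have "1/2 \<le> ln (2::real)" using ln2_ge_two_thirds by simp
    ultimately have "(1/2) / c\<^sup>2 \<le> L" unfolding L_def by (intro divide_right_mono) auto
    then show ?thesis using M by simp
  qed
  have "ln (4 / c\<^sup>2) = 2 * ln 2 + 2 * ln (1 / c)"
  proof -
    have "4 / c\<^sup>2 = (2 * (1 / c))\<^sup>2" by (simp add: power2_eq_square)
    then have "ln (4 / c\<^sup>2) = 2 * ln (2 * (1 / c))" using c by (simp add: ln_realpow)
    also have "ln (2 * (1 / c)) = ln 2 + ln (1 / c)" using c by (intro ln_mult_pos) auto
    finally show ?thesis by simp
  qed
  also have "\<dots> \<le> 2 + 2 * ln (1 / c)" using ln_le_minus_one[of "2::real"] by simp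
  finally have "ln (4 / c\<^sup>2) / c\<^sup>2 \<le> (2 + 2 * ln (1 / c)) / c\<^sup>2" by (intro divide_right_mono) auto
  then have "ln (4 / c\<^sup>2) / c\<^sup>2 \<le> 2 * (1 / c\<^sup>2) + 2 * L" by (simp add: L_def add_divide_distrib)
  then have "4 + 2 * M + 96 * (1 / c\<^sup>2) + 8 * (ln (4 / c\<^sup>2) / c\<^sup>2) \<le> 300 * (M + L)"
    using sq M L by argo
  then show ?thesis by (simp add: L_def M_def)
qed

subsection \<open>Transition time and rate\<close>

lemma transition_time:
  fixes x :: "nat \<Rightarrow> real^2"
  assumes n: "n \<ge> 1" and x: "\<And>i. i < n \<Longrightarrow> norm (x i) \<le> 1"
    and p: "norm p = 1" "\<And>i. i < n \<Longrightarrow> c \<le> p \<bullet> x i" and c: "0 < c" "c \<le> 1"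
    and eta_n: "real n \<le> eta" and eta_c: "32 / c\<^sup>2 * ln (256 / c\<^sup>2) \<le> eta"
    and N: "\<And>t. 1 \<le> t \<Longrightarrow> t \<le> N \<Longrightarrow> 1 / (8 * eta) < risk n x (gd n x eta t)"
  shows "real N \<le> 3 + 2 * real n / c + 96 / c\<^sup>2 + 8 * ln (4 / c\<^sup>2) / c\<^sup>2"
proof -
  \<comment> \<open>\<open>p\<close> rotated by a right angle, which completes an orthonormal frame
    of the plane.\<close>
  define q :: "real^2" where "q = vector [- (p $ 2), p $ 1]"
  have pp: "p $ 1 * p $ 1 + p $ 2 * p $ 2 = 1"
    using p(1) by (simp add: norm_eq_1 inner_vec_def sum_2)
  have nq: "norm q = 1"
    using pp by (simp add: norm_eq_1 inner_vec_def sum_2 q_def)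
  have inner_pq: "v \<bullet> w = (p \<bullet> v) * (p \<bullet> w) + (q \<bullet> v) * (q \<bullet> w)" for v w :: "real^2"
  proof -
    have "(p \<bullet> v) * (p \<bullet> w) + (q \<bullet> v) * (q \<bullet> w)
        = (p $ 1 * p $ 1 + p $ 2 * p $ 2) * (v $ 1 * w $ 1 + v $ 2 * w $ 2)"
      by (simp add: inner_vec_def sum_2 q_def algebra_simps)
    then show ?thesis by (simp only: pp) (simp add: inner_vec_def sum_2)
  qed
  have step: "u \<bullet> gd n x eta (Suc t) = u \<bullet> gd n x eta t
      + eta / real n * (\<Sum>i<n. sigm (gd n x eta t \<bullet> x i) * (u \<bullet> x i))" for u t
    using inner_risk_grad[of n x "gd n x eta t" u]
    by (simp add: inner_diff_right inner_commute)
  have le_1: "\<bar>u \<bullet> x i\<bar> \<le> 1" if "norm u = 1" "i < n" for u i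
    using Cauchy_Schwarz_ineq2[of u "x i"] x[of i] that by simp
  interpret planar_gd n "\<lambda>i. p \<bullet> x i" "\<lambda>i. q \<bullet> x i" eta c "\<lambda>t. p \<bullet> gd n x eta t" "\<lambda>t. q \<bullet> gd n x eta t"
  proof
    fix t
    show "p \<bullet> gd n x eta (Suc t) = p \<bullet> gd n x eta t + eta / real n * (\<Sum>i<n.
        sigm (p \<bullet> gd n x eta t * (p \<bullet> x i) + q \<bullet> gd n x eta t * (q \<bullet> x i)) * (p \<bullet> x i))"
      unfolding inner_pq[symmetric] by (rule step)
    show "q \<bullet> gd n x eta (Suc t) = q \<bullet> gd n x eta t + eta / real n * (\<Sum>i<n.
        sigm (p \<bullet> gd n x eta t * (p \<bullet> x i) + q \<bullet> gd n x eta t * (q \<bullet> x i)) * (q \<bullet> x i))"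
      unfolding inner_pq[symmetric] by (rule step)
  next
    fix i assume "i < n"
    then show "\<bar>q \<bullet> x i\<bar> \<le> 1" by (rule le_1[OF nq])
  qed (use n p(2) c eta_n eta_c in auto)
  have "loss t = risk n x (gd n x eta t)" for t
    unfolding loss_def margin_def risk_def inner_pq[symmetric] ..
  then show ?thesis using N by (intro unsettled_time) simp
qed

theorem theorem1:
  shows "\<exists>C1>0. \<exists>C2>0. \<forall>(n::nat) (x::nat \<Rightarrow> real^2) (eta::real).
    n \<ge> 1 \<longrightarrow>
    (\<forall>i<n. norm (x i) \<le> 1) \<longrightarrow>
    (\<exists>w::real^2. \<forall>i<n. w \<bullet> x i > 0) \<longrightarrow>
    eta \<ge> max (real n) (32 / (max_margin n x)\<^sup>2 * ln (256 / (max_margin n x)\<^sup>2)) \<longrightarrow>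
    (\<exists>\<tau>::nat.
       risk n x (gd n x eta \<tau>) \<le> 1 / (8 * eta) \<and>
       (\<forall>s<\<tau>. risk n x (gd n x eta s) > 1 / (8 * eta)) \<and>
       real \<tau> \<le> C1 * (real n / max_margin n x
                       + ln (1 / max_margin n x) / (max_margin n x)\<^sup>2) \<and>
       (\<forall>t::nat. t > \<tau> \<longrightarrow>
          risk n x (gd n x eta t)
            \<le> C2 / (eta * (max_margin n x)\<^sup>2 * real (t - \<tau>))))"
proof -
  have main: "\<exists>\<tau>::nat.
       risk n x (gd n x eta \<tau>) \<le> 1 / (8 * eta) \<and>
       (\<forall>s<\<tau>. risk n x (gd n x eta s) > 1 / (8 * eta)) \<and>
       real \<tau> \<le> 300 * (real n / max_margin n x
                       + ln (1 / max_margin n x) / (max_margin n x)\<^sup>2) \<and>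
       (\<forall>t::nat. t > \<tau> \<longrightarrow>
          risk n x (gd n x eta t)
            \<le> 8 / (eta * (max_margin n x)\<^sup>2 * real (t - \<tau>)))"
    if n: "n \<ge> 1" and x: "\<forall>i<n. norm (x i) \<le> 1" and sep: "\<exists>w::real^2. \<forall>i<n. w \<bullet> x i > 0"
      and eta: "eta \<ge> max (real n) (32 / (max_margin n x)\<^sup>2 * ln (256 / (max_margin n x)\<^sup>2))"
    for n :: nat and x :: "nat \<Rightarrow> real^2" and eta :: real
  proof -
    define c where "c = max_margin n x"
    obtain p where p: "norm p = 1" "\<And>i. i < n \<Longrightarrow> c \<le> p \<bullet> x i" and c: "0 < c" "c \<le> 1"
      using max_margin_attained[OF n _ sep] x unfolding c_def by blast
    have eta_n: "real n \<le> eta" and eta_c: "32 / c\<^sup>2 * ln (256 / c\<^sup>2) \<le> eta"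
      using eta by (auto simp: c_def)
    have eta_pos: "0 < eta" using n eta_n by linarith
    define r where "r t = risk n x (gd n x eta t)" for t
    define B where "B = 3 + 2 * real n / c + 96 / c\<^sup>2 + 8 * ln (4 / c\<^sup>2) / c\<^sup>2"
    have bound: "real N \<le> B" if "\<And>t. 1 \<le> t \<Longrightarrow> t \<le> N \<Longrightarrow> 1 / (8 * eta) < r t" for N
      using transition_time[OF n _ p c eta_n eta_c, where N = N] x that by (simp add: r_def B_def)
    \<comment> \<open>If the threshold were never reached, \<open>bound\<close> would hold for every
      \<open>N\<close>, contradicting the Archimedean property.\<close>
    have "\<exists>t. r t \<le> 1 / (8 * eta)"
    proof (rule ccontr)
      assume none: "\<nexists>t. r t \<le> 1 / (8 * eta)"
      have "real N \<le> B" for N by (rule bound) (use none in \<open>simp add: not_le\<close>)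
      then show False using reals_Archimedean2[of B] by (meson linorder_not_less)
    qed
    then obtain \<tau> where \<tau>: "r \<tau> \<le> 1 / (8 * eta)" "\<And>s. s < \<tau> \<Longrightarrow> 1 / (8 * eta) < r s"
      using exists_least_iff[of "\<lambda>t. r t \<le> 1 / (8 * eta)"] by (auto simp: not_le)
    \<comment> \<open>\<open>bound\<close> covers only times strictly before \<open>\<tau>\<close>;
      the extra step is why \<open>time_bound_absorb\<close> starts with 4 where \<open>B\<close>
      has 3.\<close>
    have "real (\<tau> - 1) \<le> B" using \<tau>(2) by (intro bound) auto
    then have "real \<tau> \<le> 300 * (real n / c + ln (1 / c) / c\<^sup>2)"
      using time_bound_absorb[OF c n] unfolding B_def by linarith
    moreover have "r t \<le> 8 / (eta * c\<^sup>2 * real (t - \<tau>))" if t: "\<tau> < t" for t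
    proof -
      define k where "k = real (t - \<tau>)"
      have "k * (eta * c\<^sup>2 / 8) \<le> 1 / r t"
        using stable_phase[OF n _ eta_n \<tau>(1)[unfolded r_def] p(1) c(1) p(2), where k = "t - \<tau>"] x t
        by (simp add: r_def k_def)
      moreover have "0 < r t" unfolding r_def by (rule risk_pos[OF n])
      moreover have "0 < eta * c\<^sup>2 * k" using t eta_pos c by (simp add: k_def)
      ultimately show ?thesis unfolding k_def[symmetric] by (simp add: field_simps)
    qed
    ultimately show ?thesis using \<tau> unfolding r_def c_def by blast
  qed
  show ?thesis
    apply (rule exI[of _ 300], rule conjI, simp)
    apply (rule exI[of _ 8], rule conjI, simp)
    apply (intro allI impI)
    apply (rule main)
       apply assumption+
    done
qed

end
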